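(* Let $F\in\{1_{4,1},\,F_{10},\,0_{4,1},\,F_{10}^c\}$. Then, as $m\to\infty$, $$\mathrm{forb}(m,\{Q_3,F\})=\Theta(m).$$
   Context: A matrix is simple if it is a $(0,1)$-matrix with no repeated columns. $F\prec A$ means that some submatrix of $A$ is a row and column permutation of $F$. For a family $\mathcal F$ of $(0,1)$-matrices, $\mathrm{forb}(m,\mathcal F)$ is the maximum number of columns of an $m$-rowed simple matrix $A$ with $F\nprec A$ for all $F\in\mathcal F$. $A^c$ denotes the $(0,1)$-complement of $A$. $1_{4,1}$ (resp. $0_{4,1}$) is the $4\times 1$ column of $1$'s (resp. $0$'s), and $$Q_3=\begin{bmatrix}0&0&0&1&1&1\\0&1&1&0&0&1\end{bmatrix},\qquad F_{10}=\begin{bmatrix}1&0&0\\0&1&0\\0&0&1\\0&0&0\end{bmatrix}.$$ *)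

theory Defs
  imports
    "Jordan_Normal_Form.DL_Submatrix"
    "HOL-Combinatorics.Permutations"
    "HOL-Library.Landau_Symbols"
begin

definition zero_one_mat :: "int mat \<Rightarrow> bool" where
  "zero_one_mat A \<longleftrightarrow> elements_mat A \<subseteq> {0, 1}"

definition simple_mat :: "int mat \<Rightarrow> bool" where
  "simple_mat A \<longleftrightarrow> zero_one_mat A \<and> distinct (cols A)"

definition row_col_perm :: "int mat \<Rightarrow> int mat \<Rightarrow> bool" where
  "row_col_perm F B \<longleftrightarrow>
     (\<exists>p q. p permutes {..<dim_row F} \<and> q permutes {..<dim_col F} \<and>
       B = mat (dim_row F) (dim_col F) (\<lambda>(i, j). F $$ (p i, q j)))"

definition in_config :: "int mat \<Rightarrow> int mat \<Rightarrow> bool"  (infix "\<prec>\<^sub>c" 50) where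
  "F \<prec>\<^sub>c A \<longleftrightarrow> (\<exists>I J. row_col_perm F (submatrix A I J))"

definition avoiding :: "nat \<Rightarrow> int mat set \<Rightarrow> int mat set" where
  "avoiding m \<F> = {A. dim_row A = m \<and> simple_mat A \<and> (\<forall>F\<in>\<F>. \<not> F \<prec>\<^sub>c A)}"

definition forb :: "nat \<Rightarrow> int mat set \<Rightarrow> nat" where
  "forb m \<F> = Max (dim_col ` avoiding m \<F>)"

definition mat_compl :: "int mat \<Rightarrow> int mat" where
  "mat_compl A = map_mat (\<lambda>x. 1 - x) A"

definition ones_col4 :: "int mat" where
  "ones_col4 = mat 4 1 (\<lambda>_. 1)"

definition zeros_col4 :: "int mat" where
  "zeros_col4 = 0\<^sub>m 4 1"

definition Q3 :: "int mat" where
  "Q3 = mat_of_rows_list 6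
     [[0, 0, 0, 1, 1, 1],
      [0, 1, 1, 0, 0, 1]]"

definition F10 :: "int mat" where
  "F10 = mat_of_rows_list 3
     [[1, 0, 0],
      [0, 1, 0],
      [0, 0, 1],
      [0, 0, 0]]"

text \<open>The maximum in \<open>forb\<close> is over a finite set, which is nonempty as soon as every
  forbidden matrix has at least one column (then the matrix without columns qualifies).\<close>

lemma dim_col_simple_mat_le:
  assumes "simple_mat A"
  shows "dim_col A \<le> 2 ^ dim_row A"
proof -
  let ?L = "{xs :: int list. set xs \<subseteq> {0, 1} \<and> length xs = dim_row A}"
  have fin: "finite ?L" by (rule finite_lists_length_eq) simp
  have "set (cols A) \<subseteq> vec_of_list ` ?L"
  proof
    fix v assume "v \<in> set (cols A)"
    then obtain j where j: "j < dim_col A" "v = col A j"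
      by (auto simp: cols_def)
    have "A $$ (i, j) \<in> {0, 1}" if "i < dim_row A" for i
      using assms j(1) that elements_matI[of A "dim_row A" "dim_col A" i j]
      unfolding simple_mat_def zero_one_mat_def by blast
    moreover have "set (list_of_vec v) = (\<lambda>i. A $$ (i, j)) ` {..<dim_row A}"
      using j by (auto simp: set_list_of_vec vec_set_def col_def)
    ultimately have "set (list_of_vec v) \<subseteq> {0, 1}" by auto
    then have "list_of_vec v \<in> ?L"
      using j by simp
    moreover have "v = vec_of_list (list_of_vec v)" by (simp add: vec_list)
    ultimately show "v \<in> vec_of_list ` ?L" by blast
  qed
  then have "card (set (cols A)) \<le> card (vec_of_list ` ?L)"
    using fin by (intro card_mono) auto
  also have "\<dots> \<le> card ?L" using fin by (rule card_image_le)
  also have "\<dots> = 2 ^ dim_row A" by (subst card_lists_length_eq) (auto simp: numeral_2_eq_2)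
  finally show ?thesis
    using assms distinct_card[of "cols A"] by (simp add: simple_mat_def)
qed

lemma finite_dim_col_avoiding: "finite (dim_col ` avoiding m \<F>)"
  by (rule finite_subset[of _ "{..2 ^ m}"])
     (auto simp: avoiding_def dest: dim_col_simple_mat_le)

lemma avoiding_nonempty:
  assumes "\<And>F. F \<in> \<F> \<Longrightarrow> dim_col F > 0"
  shows "avoiding m \<F> \<noteq> {}"
proof -
  have "\<not> F \<prec>\<^sub>c 0\<^sub>m m 0" if "F \<in> \<F>" for F
  proof
    assume "F \<prec>\<^sub>c 0\<^sub>m m 0"
    then obtain I J where "row_col_perm F (submatrix (0\<^sub>m m 0) I J)"
      by (auto simp: in_config_def)
    then have "dim_col F = dim_col (submatrix (0\<^sub>m m 0 :: int mat) I J)"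
      by (auto simp: row_col_perm_def)
    then show False using assms[OF that] by (simp add: dim_submatrix)
  qed
  then have "0\<^sub>m m 0 \<in> avoiding m \<F>"
    by (auto simp: avoiding_def simple_mat_def zero_one_mat_def elements_mat_def cols_def)
  then show ?thesis by blast
qed

end

theory Submission
  imports Defs
begin

text \<open>Regard a simple matrix as a family \<open>\<F>\<close> of subsets of its set of rows. As \<open>Q3\<close> is its own
  complement up to a permutation of columns, it suffices to treat \<open>F10\<close> and the zero column, and both
  occur in the \<open>4 \<times> 4\<close> configuration ``star'' obtained by appending a zero column to \<open>F10\<close>.

  Let \<open>x\<close> be a row of maximal degree and \<open>C\<close> the family of those \<open>S\<close> with \<open>x \<notin> S\<close> for which both
  \<open>S\<close> and \<open>insert x S\<close> belong to \<open>\<F>\<close>. Deleting row \<open>x\<close> loses exactly \<open>card C\<close> columns, so a linear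
  bound follows from \<open>card C \<le> 3\<close>. Suppose \<open>card C \<ge> 4\<close>. If a row \<open>y\<close> is in at least two members of
  \<open>C\<close> and missed by at least one, then avoiding \<open>Q3\<close> on the rows \<open>x, y\<close> forces at most one column
  with \<open>x\<close> but not \<open>y\<close>, whence the degree of \<open>y\<close> exceeds that of \<open>x\<close>, a contradiction. So every row
  is in all members of \<open>C\<close> or in at most one; then all but at most one member of \<open>C\<close> have a private
  row, and together with the row \<open>x\<close> they give a star.

  For the lower bound, the complement of the identity matrix has no two zeros in a column.\<close>

section \<open>Set families: deleting a row of maximal degree\<close>

text \<open>The four alternatives say which column type of \<open>Q3\<close> falls short on the rows
  \<open>x\<close>, \<open>y\<close>: no 00, no 11, at most one 10, or at most one 01. No ground set
  is needed: an element outside \<open>\<Union>\<F>\<close> satisfies the second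
  alternative.\<close>

definition Q3_free :: "'a set set \<Rightarrow> bool" where
  "Q3_free \<F> \<longleftrightarrow> (\<forall>x y. x \<noteq> y \<longrightarrow>
     (\<forall>S\<in>\<F>. x \<in> S \<or> y \<in> S) \<or> (\<forall>S\<in>\<F>. x \<notin> S \<or> y \<notin> S) \<or>
     card {S\<in>\<F>. x \<in> S \<and> y \<notin> S} \<le> 1 \<or> card {S\<in>\<F>. y \<in> S \<and> x \<notin> S} \<le> 1)"

text \<open>The rows \<open>a\<close>, \<open>b\<close>, \<open>c\<close> occur in \<open>P\<close>,
  \<open>Q\<close>, \<open>R\<close>, but none of the four sets contains \<open>d\<close>; the
  condition \<open>d \<in> \<Union>\<F>\<close> ensures that \<open>d\<close> is an actual
  row.\<close>

inductive has_star :: "'a set set \<Rightarrow> bool" for \<F> where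
  has_starI: "distinct [a, b, c, d] \<Longrightarrow> d \<in> \<Union>\<F> \<Longrightarrow> {P, Q, R, S} \<subseteq> \<F> \<Longrightarrow>
     P \<inter> {a, b, c, d} = {a} \<Longrightarrow> Q \<inter> {a, b, c, d} = {b} \<Longrightarrow>
     R \<inter> {a, b, c, d} = {c} \<Longrightarrow> S \<inter> {a, b, c, d} = {} \<Longrightarrow> has_star \<F>"

definition twins :: "'a \<Rightarrow> 'a set set \<Rightarrow> 'a set set" where
  "twins x \<F> = {S\<in>\<F>. x \<notin> S \<and> insert x S \<in> \<F>}"

text \<open>Deleting \<open>x\<close> identifies \<open>S\<close> with \<open>insert x S\<close> and
  nothing else, so each member of \<open>twins x \<F>\<close> accounts for exactly one lost
  set.\<close>

lemma card_trace:
  assumes "finite \<F>"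
  shows "card \<F> = card ((\<lambda>S. S - {x}) ` \<F>) + card (twins x \<F>)"
proof -
  let ?N = "{S\<in>\<F>. x \<notin> S}" and ?Y = "{S\<in>\<F>. x \<in> S}" and ?d = "\<lambda>S. S - {x}"
  have inj: "inj_on ?d ?Y" by (auto simp: inj_on_def)
  have "\<F> = ?N \<union> ?Y" by auto
  then have "card \<F> = card ?N + card ?Y"
    using assms card_Un_disjoint[of ?N ?Y] by force
  also have "card ?Y = card (?d ` ?Y)" using inj by (simp add: card_image)
  also have "card ?N + card (?d ` ?Y) = card (?N \<union> ?d ` ?Y) + card (?N \<inter> ?d ` ?Y)"
    using assms by (intro card_Un_Int) auto
  also have "?N \<union> ?d ` ?Y = ?d ` \<F>"
  proof -
    have "?N = ?d ` ?N" by force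
    then show ?thesis using \<open>\<F> = ?N \<union> ?Y\<close> by blast
  qed
  also have "?N \<inter> ?d ` ?Y = twins x \<F>"
  proof -
    have "S \<in> ?d ` ?Y" if "x \<notin> S" "insert x S \<in> \<F>" for S
      using that by (intro image_eqI[of _ _ "insert x S"]) auto
    then show ?thesis by (auto simp: twins_def insert_absorb)
  qed
  finally show ?thesis .
qed

text \<open>For rows other than \<open>x\<close>, the trace can only merge sets and hence lower the
  two counts. For a pair involving \<open>x\<close>, one count vanishes because no trace contains
  \<open>x\<close>.\<close>

lemma Q3_free_trace:
  assumes "finite \<F>" "Q3_free \<F>"
  shows "Q3_free ((\<lambda>S. S - {x}) ` \<F>)"
  unfolding Q3_free_def
proof (intro allI impI)
  fix y z :: 'a assume "y \<noteq> z"
  let ?\<G> = "(\<lambda>S. S - {x}) ` \<F>"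
  have le: "card {S\<in>?\<G>. u \<in> S \<and> v \<notin> S} \<le> card {S\<in>\<F>. u \<in> S \<and> v \<notin> S}" if "v \<noteq> x" for u v
  proof -
    have "{S\<in>?\<G>. u \<in> S \<and> v \<notin> S} \<subseteq> (\<lambda>S. S - {x}) ` {S\<in>\<F>. u \<in> S \<and> v \<notin> S}"
      using that by auto
    then show ?thesis
      using assms(1) by (intro surj_card_le) auto
  qed
  have empty: "{S\<in>?\<G>. x \<in> S \<and> v \<notin> S} = {}" for v by auto
  show "(\<forall>S\<in>?\<G>. y \<in> S \<or> z \<in> S) \<or> (\<forall>S\<in>?\<G>. y \<notin> S \<or> z \<notin> S) \<or>
     card {S\<in>?\<G>. y \<in> S \<and> z \<notin> S} \<le> 1 \<or> card {S\<in>?\<G>. z \<in> S \<and> y \<notin> S} \<le> 1"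
  proof (cases "y = x \<or> z = x")
    case True
    then show ?thesis using empty by (metis card.empty zero_le)
  next
    case False
    then have "(\<forall>S\<in>\<F>. y \<in> S \<or> z \<in> S) \<or> (\<forall>S\<in>\<F>. y \<notin> S \<or> z \<notin> S) \<or>
      card {S\<in>\<F>. y \<in> S \<and> z \<notin> S} \<le> 1 \<or> card {S\<in>\<F>. z \<in> S \<and> y \<notin> S} \<le> 1"
      using assms(2) \<open>y \<noteq> z\<close> unfolding Q3_free_def by blast
    then show ?thesis
      using False le[of z y] le[of y z] by (elim disjE) auto
  qed
qed

text \<open>Each of the four rows lies in some trace and so differs from \<open>x\<close>; preimages
  of the four sets therefore meet these rows in the same way.\<close>

lemma has_star_trace:
  assumes "has_star ((\<lambda>S. S - {x}) ` \<F>)"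
  shows "has_star \<F>"
proof -
  let ?d = "\<lambda>S. S - {x}"
  obtain a b c d P' Q' R' S' where dist: "distinct [a, b, c, d]" and d: "d \<in> \<Union>(?d ` \<F>)"
    and sub: "{P', Q', R', S'} \<subseteq> ?d ` \<F>"
    and traces: "P' \<inter> {a, b, c, d} = {a}" "Q' \<inter> {a, b, c, d} = {b}"
      "R' \<inter> {a, b, c, d} = {c}" "S' \<inter> {a, b, c, d} = {}"
    using assms by (rule has_star.cases)
  obtain P Q R S where PQRS: "{P, Q, R, S} \<subseteq> \<F>" "P' = ?d P" "Q' = ?d Q" "R' = ?d R" "S' = ?d S"
    using sub by auto
  have "x \<notin> {a, b, c, d}" using d traces PQRS by blast
  then have "?d T \<inter> {a, b, c, d} = T \<inter> {a, b, c, d}" for T by blast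
  then have "P \<inter> {a, b, c, d} = {a}" "Q \<inter> {a, b, c, d} = {b}"
      "R \<inter> {a, b, c, d} = {c}" "S \<inter> {a, b, c, d} = {}"
    using traces unfolding PQRS by metis+
  moreover have "d \<in> \<Union>\<F>" using d by blast
  ultimately show ?thesis using dist PQRS(1) by (intro has_starI)
qed

lemma twins_dichotomy:
  assumes fin: "finite \<F>" and Q3: "Q3_free \<F>" and "x \<noteq> y"
    and deg: "card {S\<in>\<F>. y \<in> S} \<le> card {S\<in>\<F>. x \<in> S}"
    and four: "card (twins x \<F>) \<ge> 4"
    and T: "T \<in> twins x \<F>" "y \<notin> T"
  shows "card {S\<in>twins x \<F>. y \<in> S} \<le> 1"
proof (rule ccontr)
  let ?C = "twins x \<F>"
  let ?Y = "{S\<in>?C. y \<in> S}" and ?N = "{S\<in>?C. y \<notin> S}"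
  let ?XY = "{S\<in>\<F>. x \<in> S \<and> y \<notin> S}" and ?YX = "{S\<in>\<F>. y \<in> S \<and> x \<notin> S}"
    and ?B = "{S\<in>\<F>. x \<in> S \<and> y \<in> S}"
  assume "\<not> card ?Y \<le> 1"
  then have Y: "card ?Y \<ge> 2" by simp
  have finC: "finite ?C" using fin by (simp add: twins_def)
  have "?C = ?Y \<union> ?N" by auto
  then have C: "card ?C = card ?Y + card ?N"
    using finC card_Un_disjoint[of ?Y ?N] by force
  have YX: "card ?Y \<le> card ?YX"
    using fin by (intro card_mono) (auto simp: twins_def)
  have "inj_on (insert x) ?N"
    by (auto simp: inj_on_def twins_def)
  then have XY: "card ?N \<le> card ?XY"
    using fin \<open>x \<noteq> y\<close> by (intro card_inj_on_le) (auto simp: twins_def)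
  obtain S where "S \<in> ?Y"
    using Y by (metis card.empty ex_in_conv not_numeral_le_zero)
  \<comment> \<open>On the rows \<open>x\<close>, \<open>y\<close> these two sets are the columns 11
    and 00 of \<open>Q3\<close>, so one of the two mixed types occurs at most once. It is not
    \<open>?YX\<close>, which is at least as large as \<open>?Y\<close>.\<close>
  then have "insert x S \<in> \<F>" "y \<in> insert x S" "T \<in> \<F>" "x \<notin> T"
    using T by (auto simp: twins_def)
  then have "card ?XY \<le> 1 \<or> card ?YX \<le> 1"
    using Q3[unfolded Q3_free_def, rule_format, OF \<open>x \<noteq> y\<close>] T(2) by blast
  then have "card ?XY < card ?YX"
    using Y C YX XY four by linarith
  moreover have "card {S\<in>\<F>. x \<in> S} = card ?XY + card ?B"
  proof -
    have "{S\<in>\<F>. x \<in> S} = ?XY \<union> ?B" by auto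
    then show ?thesis using fin card_Un_disjoint[of ?XY ?B] by force
  qed
  moreover have "card {S\<in>\<F>. y \<in> S} = card ?YX + card ?B"
  proof -
    have "{S\<in>\<F>. y \<in> S} = ?YX \<union> ?B" by auto
    then show ?thesis using fin card_Un_disjoint[of ?YX ?B] by force
  qed
  ultimately show False using deg by linarith
qed

lemma has_star_if_card_twins:
  assumes fin: "finite \<F>" and Q3: "Q3_free \<F>"
    and deg: "\<And>y. card {S\<in>\<F>. y \<in> S} \<le> card {S\<in>\<F>. x \<in> S}"
    and four: "card (twins x \<F>) \<ge> 4"
  shows "has_star \<F>"
proof -
  let ?C = "twins x \<F>"
  define has_private where "has_private S \<longleftrightarrow> (\<exists>y\<in>S. \<forall>T\<in>?C. T \<noteq> S \<longrightarrow> y \<notin> T)" for S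
  have finC: "finite ?C" using fin by (simp add: twins_def)
  \<comment> \<open>By the dichotomy, a row that separates two twins lies in only one twin.\<close>
  have has_private: "has_private S" if "S \<in> ?C" "T \<in> ?C" "y \<in> S" "y \<notin> T" for S T y
  proof -
    have "x \<noteq> y" using that by (auto simp: twins_def)
    then have "card {S\<in>?C. y \<in> S} \<le> 1"
      using twins_dichotomy[OF fin Q3 _ deg four] that by blast
    then have "U = S" if "U \<in> ?C" "y \<in> U" for U
      using that \<open>S \<in> ?C\<close> \<open>y \<in> S\<close> finC by (auto simp: card_le_Suc0_iff_eq)
    then show ?thesis using \<open>y \<in> S\<close> unfolding has_private_def by blast
  qed
  \<comment> \<open>Two distinct twins are separated by some row, which is then private to one of
    them.\<close>
  have one: "S = T" if "S \<in> ?C" "T \<in> ?C" "\<not> has_private S" "\<not> has_private T" for S T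
    using that has_private by blast
  \<comment> \<open>\<open>S\<close> is the twin without a private row if there is one, and
    arbitrary otherwise. It becomes the zero column of the star.\<close>
  obtain S where S: "S \<in> ?C" "\<And>T. T \<in> ?C \<Longrightarrow> T \<noteq> S \<Longrightarrow> has_private T"
  proof (cases "\<exists>S\<in>?C. \<not> has_private S")
    case True
    then show ?thesis using that one by blast
  next
    case False
    moreover have "?C \<noteq> {}" using four by force
    ultimately show ?thesis using that by blast
  qed
  have "card (?C - {S}) \<ge> 3" using four S(1) finC by simp
  then obtain D where "D \<subseteq> ?C - {S}" "card D = 3"
    by (meson obtain_subset_with_card_n)
  then obtain P Q R where PQR: "{P, Q, R} \<subseteq> ?C - {S}" "P \<noteq> Q" "P \<noteq> R" "Q \<noteq> R"
    by (auto simp: card_3_iff)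
  then have "has_private P" "has_private Q" "has_private R" using S(2) by auto
  then obtain a b c where
    a: "a \<in> P" "\<forall>T\<in>?C. T \<noteq> P \<longrightarrow> a \<notin> T" and
    b: "b \<in> Q" "\<forall>T\<in>?C. T \<noteq> Q \<longrightarrow> b \<notin> T" and
    c: "c \<in> R" "\<forall>T\<in>?C. T \<noteq> R \<longrightarrow> c \<notin> T"
    unfolding has_private_def by (elim bexE) (rule that)
  \<comment> \<open>No twin contains \<open>x\<close>, yet \<open>x\<close> lies in
    \<open>\<Union>\<F>\<close>, so it can serve as the fourth row of the star.\<close>
  have x: "x \<notin> P" "x \<notin> Q" "x \<notin> R" "x \<notin> S" "x \<in> \<Union>\<F>" and sub: "{P, Q, R, S} \<subseteq> \<F>"
    using PQR S(1) by (auto simp: twins_def)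
  have "P \<in> ?C" "Q \<in> ?C" "R \<in> ?C" "P \<noteq> S" "Q \<noteq> S" "R \<noteq> S" using PQR by auto
  then have "a \<notin> Q" "a \<notin> R" "a \<notin> S" "b \<notin> P" "b \<notin> R" "b \<notin> S" "c \<notin> P" "c \<notin> Q" "c \<notin> S"
    using a(2) b(2) c(2) PQR(2-) S(1) by metis+
  then have "distinct [a, b, c, x]" "P \<inter> {a, b, c, x} = {a}" "Q \<inter> {a, b, c, x} = {b}"
     "R \<inter> {a, b, c, x} = {c}" "S \<inter> {a, b, c, x} = {}"
    using a(1) b(1) c(1) x(1-4) by auto
  then show ?thesis
    using x(5) sub by (intro has_starI)
qed

text \<open>Induction on the number of rows: deleting a row of maximal degree costs at most three
  sets, and without rows only the empty set can remain.\<close>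

lemma card_le_if_no_star:
  assumes "finite V" "\<Union>\<F> \<subseteq> V" "Q3_free \<F>" "\<not> has_star \<F>"
  shows "card \<F> \<le> 3 * card V + 1"
  using assms
proof (induction "card V" arbitrary: V \<F>)
  case 0
  then have "\<F> \<subseteq> {{}}" by auto
  then have "card \<F> \<le> card {{} :: 'a set}" by (intro card_mono) auto
  then show ?case by simp
next
  case (Suc n)
  have "\<F> \<subseteq> Pow V" using Suc.prems by blast
  then have fin: "finite \<F>" using Suc.prems by (meson finite_Pow_iff finite_subset)
  let ?deg = "\<lambda>y. card {S\<in>\<F>. y \<in> S}"
  have "V \<noteq> {}" using Suc.hyps by auto
  then have "Max (?deg ` V) \<in> ?deg ` V" using Suc.prems by simp
  then obtain x where x: "x \<in> V" "?deg x = Max (?deg ` V)" by force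
  \<comment> \<open>The maximum is taken over \<open>V\<close>, but elements outside
    \<open>V\<close> have degree 0.\<close>
  have deg: "?deg y \<le> ?deg x" for y
  proof (cases "y \<in> V")
    case True
    then show ?thesis using x Suc.prems by simp
  next
    case False
    then have "{S\<in>\<F>. y \<in> S} = {}" using Suc.prems by blast
    then show ?thesis by (metis card.empty zero_le)
  qed
  have "card (twins x \<F>) \<le> 3"
    using has_star_if_card_twins[OF fin Suc.prems(3) deg] Suc.prems(4) by fastforce
  moreover have "card ((\<lambda>S. S - {x}) ` \<F>) \<le> 3 * card (V - {x}) + 1"
    using Suc.prems Suc.hyps x fin
    by (intro Suc.hyps Q3_free_trace notI) (auto dest: has_star_trace)
  ultimately show ?case
    using card_trace[OF fin, of x] Suc.hyps Suc.prems x by simp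
qed

section \<open>Configurations as pairs of injective index maps\<close>

lemma pick_bij_betw:
  assumes "I \<subseteq> {..<n}"
  shows "bij_betw (pick I) {..<card I} I"
proof -
  have fin: "finite I" using assms finite_subset by blast
  have inj: "inj_on (pick I) {..<card I}"
    by (auto intro!: linorder_inj_onI simp: less_imp_neq pick_mono_le)
  have "pick I ` {..<card I} \<subseteq> I" by (auto intro: pick_in_set_le)
  moreover have "card (pick I ` {..<card I}) = card I" using inj by (simp add: card_image)
  ultimately have "pick I ` {..<card I} = I" using fin card_subset_eq by blast
  then show ?thesis using inj by (simp add: bij_betw_def)
qed

text \<open>An injection from \<open>{..<k}\<close> differs from the increasing enumeration of its
  range only by a permutation of \<open>{..<k}\<close>. This separates the choice of a submatrix
  from the reordering of its lines.\<close>

lemma permutes_factor_pick: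
  assumes "inj_on r {..<k}" "r ` {..<k} \<subseteq> {..<n}"
  obtains p where "p permutes {..<k}" "\<And>i. i < k \<Longrightarrow> r (p i) = pick (r ` {..<k}) i"
proof -
  define I where "I = r ` {..<k}"
  have card: "card I = k" using assms by (simp add: I_def card_image)
  have r: "bij_betw r {..<k} I" using assms by (simp add: I_def bij_betw_def)
  have pick: "bij_betw (pick I) {..<k} I"
    using pick_bij_betw[of I n] assms card by (simp add: I_def)
  define p where "p = (\<lambda>i. if i < k then inv_into {..<k} r (pick I i) else i)"
  have "bij_betw (inv_into {..<k} r \<circ> pick I) {..<k} {..<k}"
    using pick bij_betw_inv_into[OF r] by (rule bij_betw_trans)
  then have "bij_betw p {..<k} {..<k}"
    by (rule bij_betw_cong[THEN iffD1, rotated]) (simp add: p_def)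
  then have "p permutes {..<k}"
    by (rule bij_imp_permutes) (simp add: p_def)
  moreover have "r (p i) = pick I i" if "i < k" for i
    using that pick r by (auto simp: p_def bij_betw_def intro!: f_inv_into_f)
  ultimately show thesis using that unfolding I_def by blast
qed

text \<open>The index maps are the enumerations of the selected rows and columns composed with the
  inverses of the two permutations.\<close>

lemma in_configE:
  assumes "F \<prec>\<^sub>c A"
  obtains r c where "inj_on r {..<dim_row F}" "r ` {..<dim_row F} \<subseteq> {..<dim_row A}"
    "inj_on c {..<dim_col F}" "c ` {..<dim_col F} \<subseteq> {..<dim_col A}"
    "\<And>i j. i < dim_row F \<Longrightarrow> j < dim_col F \<Longrightarrow> F $$ (i, j) = A $$ (r i, c j)"
proof -
  obtain I J p q where p: "p permutes {..<dim_row F}" and q: "q permutes {..<dim_col F}"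
    and sub: "submatrix A I J = mat (dim_row F) (dim_col F) (\<lambda>(i, j). F $$ (p i, q j))"
    using assms unfolding in_config_def row_col_perm_def by blast
  \<comment> \<open>\<open>I\<close> and \<open>J\<close> may contain indices beyond the dimensions
    of \<open>A\<close>, which \<open>submatrix\<close> ignores; \<open>I'\<close> and
    \<open>J'\<close> drop them.\<close>
  define I' where "I' = {i. i < dim_row A \<and> i \<in> I}"
  define J' where "J' = {j. j < dim_col A \<and> j \<in> J}"
  have dims: "dim_row F = card I'" "dim_col F = card J'"
    using dim_submatrix[of A I J] unfolding I'_def J'_def sub dim_row_mat dim_col_mat
    by (simp_all only:)
  have pick: "pick {a\<in>K. a < n} i = pick K i" if "i < card {a. a < n \<and> a \<in> K}" for K n i
    using pick_reduce_set[OF that] by (simp add: conj_commute)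
  have I: "bij_betw (pick I') {..<dim_row F} I'" and J: "bij_betw (pick J') {..<dim_col F} J'"
    unfolding dims by (rule pick_bij_betw[of _ "dim_row A"] pick_bij_betw[of _ "dim_col A"],
        force simp: I'_def J'_def)+
  have p': "bij_betw (inv_into UNIV p) {..<dim_row F} {..<dim_row F}"
    and q': "bij_betw (inv_into UNIV q) {..<dim_col F} {..<dim_col F}"
    using p q by (simp_all add: permutes_inv permutes_imp_bij)
  have r: "bij_betw (pick I' \<circ> inv_into UNIV p) {..<dim_row F} I'"
    and c: "bij_betw (pick J' \<circ> inv_into UNIV q) {..<dim_col F} J'"
    using bij_betw_trans[OF p' I] bij_betw_trans[OF q' J] by auto
  have "F $$ (i, j) = A $$ (pick I' (inv_into UNIV p i), pick J' (inv_into UNIV q j))"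
    if "i < dim_row F" "j < dim_col F" for i j
  proof -
    have i: "inv_into UNIV p i < dim_row F" and j: "inv_into UNIV q j < dim_col F"
      using p' q' that by (auto simp: bij_betw_def)
    have "submatrix A I J $$ (inv_into UNIV p i, inv_into UNIV q j) =
      A $$ (pick I (inv_into UNIV p i), pick J (inv_into UNIV q j))"
      using i j dims by (intro submatrix_index) (simp_all add: I'_def J'_def)
    moreover have "pick I' (inv_into UNIV p i) = pick I (inv_into UNIV p i)"
      "pick J' (inv_into UNIV q j) = pick J (inv_into UNIV q j)"
      using i j pick[of "inv_into UNIV p i" "dim_row A" I]
        pick[of "inv_into UNIV q j" "dim_col A" J] dims
      by (simp_all add: I'_def J'_def conj_commute)
    ultimately show ?thesis
      using i j p q by (simp add: sub permutes_inverses)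
  qed
  moreover have "(pick I' \<circ> inv_into UNIV p) ` {..<dim_row F} \<subseteq> {..<dim_row A}"
    "(pick J' \<circ> inv_into UNIV q) ` {..<dim_col F} \<subseteq> {..<dim_col A}"
    unfolding bij_betw_imp_surj_on[OF r] bij_betw_imp_surj_on[OF c]
    by (auto simp: I'_def J'_def)
  ultimately show thesis
    using that[of "pick I' \<circ> inv_into UNIV p" "pick J' \<circ> inv_into UNIV q"]
      bij_betw_imp_inj_on[OF r] bij_betw_imp_inj_on[OF c] by simp
qed

text \<open>The ranges of \<open>r\<close> and \<open>c\<close> select the submatrix;
  \<open>permutes_factor_pick\<close> supplies the two permutations.\<close>

lemma in_configI:
  assumes r: "inj_on r {..<dim_row F}" "r ` {..<dim_row F} \<subseteq> {..<dim_row A}"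
    and c: "inj_on c {..<dim_col F}" "c ` {..<dim_col F} \<subseteq> {..<dim_col A}"
    and F: "\<And>i j. i < dim_row F \<Longrightarrow> j < dim_col F \<Longrightarrow> F $$ (i, j) = A $$ (r i, c j)"
  shows "F \<prec>\<^sub>c A"
proof -
  define I J where "I = r ` {..<dim_row F}" and "J = c ` {..<dim_col F}"
  obtain p where p: "p permutes {..<dim_row F}" "\<And>i. i < dim_row F \<Longrightarrow> r (p i) = pick I i"
    using permutes_factor_pick[OF r] unfolding I_def by blast
  obtain q where q: "q permutes {..<dim_col F}" "\<And>j. j < dim_col F \<Longrightarrow> c (q j) = pick J j"
    using permutes_factor_pick[OF c] unfolding J_def by blast
  have "{i. i < dim_row A \<and> i \<in> I} = I" "{j. j < dim_col A \<and> j \<in> J} = J"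
    using r c by (auto simp: I_def J_def)
  then have card: "card {i. i < dim_row A \<and> i \<in> I} = dim_row F"
    "card {j. j < dim_col A \<and> j \<in> J} = dim_col F"
    using r c by (simp_all add: I_def J_def card_image)
  have "submatrix A I J = mat (dim_row F) (dim_col F) (\<lambda>(i, j). F $$ (p i, q j))"
  proof (rule eq_matI)
    fix i j assume "i < dim_row (mat (dim_row F) (dim_col F) (\<lambda>(i, j). F $$ (p i, q j)))"
      and "j < dim_col (mat (dim_row F) (dim_col F) (\<lambda>(i, j). F $$ (p i, q j)))"
    then have ij: "i < dim_row F" "j < dim_col F" by auto
    then have "p i < dim_row F" "q j < dim_col F"
      using permutes_in_image[OF p(1), of i] permutes_in_image[OF q(1), of j] by auto
    then show "submatrix A I J $$ (i, j)
      = mat (dim_row F) (dim_col F) (\<lambda>(i, j). F $$ (p i, q j)) $$ (i, j)"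
      using ij card p q F by (simp add: submatrix_index)
  qed (simp_all add: dim_submatrix card)
  then show "F \<prec>\<^sub>c A"
    using p(1) q(1) unfolding in_config_def row_col_perm_def by blast
qed

section \<open>Columns of a matrix as sets of rows\<close>

definition col_support :: "int mat \<Rightarrow> nat \<Rightarrow> nat set" where
  "col_support A j = {i. i < dim_row A \<and> A $$ (i, j) = 1}"

definition col_supports :: "int mat \<Rightarrow> nat set set" where
  "col_supports A = col_support A ` {..<dim_col A}"

lemma zero_one_matD:
  assumes "zero_one_mat A" "i < dim_row A" "j < dim_col A"
  shows "A $$ (i, j) = 0 \<or> A $$ (i, j) = 1"
  using assms elements_matI[of A "dim_row A" "dim_col A" i j]
  unfolding zero_one_mat_def by blast

lemma zero_one_matI:
  assumes "\<And>i j. i < dim_row A \<Longrightarrow> j < dim_col A \<Longrightarrow> A $$ (i, j) = 0 \<or> A $$ (i, j) = 1"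
  shows "zero_one_mat A"
  using assms by (fastforce simp: zero_one_mat_def elements_mat_def)

text \<open>A (0,1)-column is determined by its support, so distinct columns have distinct
  supports.\<close>

lemma card_col_supports:
  assumes "simple_mat A"
  shows "card (col_supports A) = dim_col A"
proof -
  have "inj_on (col_support A) {..<dim_col A}"
  proof (rule inj_onI)
    fix j k assume jk: "j \<in> {..<dim_col A}" "k \<in> {..<dim_col A}"
      and eq: "col_support A j = col_support A k"
    have "A $$ (i, j) = A $$ (i, k)" if "i < dim_row A" for i
    proof -
      have "A $$ (i, j) = 1 \<longleftrightarrow> A $$ (i, k) = 1"
        using arg_cong[OF eq, of "\<lambda>S. i \<in> S"] that by (simp add: col_support_def)
      then show ?thesis
        using zero_one_matD[of A i j] zero_one_matD[of A i k] that jk assms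
        by (auto simp: simple_mat_def)
    qed
    then have "col A j = col A k" by (auto simp: col_def)
    then have "cols A ! j = cols A ! k" using jk by simp
    then show "j = k"
      using jk assms nth_eq_iff_index_eq[of "cols A" j k] by (simp add: simple_mat_def)
  qed
  then show ?thesis by (simp add: col_supports_def card_image)
qed

text \<open>The bridge from set families to matrices: picking one column index for each listed set
  gives an injection, since equal indices have equal supports.\<close>

lemma in_config_if_col_supports:
  assumes A: "zero_one_mat A"
    and xs: "distinct xs" "set xs \<subseteq> {..<dim_row A}" "length xs = dim_row F"
    and Ss: "distinct Ss" "set Ss \<subseteq> col_supports A" "length Ss = dim_col F"
    and F: "\<And>i j. i < dim_row F \<Longrightarrow> j < dim_col F \<Longrightarrow> F $$ (i, j) = of_bool (xs ! i \<in> Ss ! j)"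
  shows "F \<prec>\<^sub>c A"
proof -
  define ix where "ix = inv_into {..<dim_col A} (col_support A)"
  have ix: "ix S < dim_col A" "col_support A (ix S) = S" if "S \<in> col_supports A" for S
    using that inv_into_into[of S "col_support A" "{..<dim_col A}"]
      f_inv_into_f[of S "col_support A" "{..<dim_col A}"]
    unfolding ix_def col_supports_def by simp_all
  have Sj: "Ss ! j \<in> col_supports A" if "j < dim_col F" for j
    using that Ss by (metis nth_mem subsetD)
  have xi: "xs ! i < dim_row A" if "i < dim_row F" for i
    using that xs by (metis lessThan_iff nth_mem subsetD)
  have "inj_on (\<lambda>j. ix (Ss ! j)) {..<dim_col F}"
  proof (rule inj_onI)
    fix j k assume jk: "j \<in> {..<dim_col F}" "k \<in> {..<dim_col F}" and "ix (Ss ! j) = ix (Ss ! k)"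
    then have "Ss ! j = Ss ! k" using jk ix(2) Sj by (metis lessThan_iff)
    then show "j = k"
      using jk Ss nth_eq_iff_index_eq[of Ss j k] by simp
  qed
  moreover have "F $$ (i, j) = A $$ (xs ! i, ix (Ss ! j))" if "i < dim_row F" "j < dim_col F" for i j
  proof -
    have "xs ! i \<in> Ss ! j \<longleftrightarrow> A $$ (xs ! i, ix (Ss ! j)) = 1"
      using ix(2)[OF Sj, of j] xi that by (auto simp: col_support_def)
    then show ?thesis
      using F[OF that] zero_one_matD[OF A xi ix(1)[OF Sj], of i j] that by auto
  qed
  moreover have "inj_on ((!) xs) {..<dim_row F}"
    using xs by (auto simp: inj_on_def nth_eq_iff_index_eq)
  ultimately show ?thesis
    using xi ix(1)[OF Sj] by (intro in_configI[of "(!) xs" _ _ "\<lambda>j. ix (Ss ! j)"]) auto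
qed

lemma dim_configs [simp]:
  "dim_row Q3 = 2" "dim_col Q3 = 6" "dim_row F10 = 4" "dim_col F10 = 3"
  "dim_row zeros_col4 = 4" "dim_col zeros_col4 = 1"
  by (simp_all add: Q3_def F10_def zeros_col4_def mat_of_rows_list_def)

lemma two_le_cardE:
  assumes "2 \<le> card A"
  obtains x y where "x \<in> A" "y \<in> A" "x \<noteq> y"
proof -
  obtain B where "B \<subseteq> A" "card B = 2"
    using assms by (meson obtain_subset_with_card_n)
  then show thesis using that by (auto simp: card_2_iff)
qed

lemma Q3_free_col_supports:
  assumes A: "zero_one_mat A" and "\<not> Q3 \<prec>\<^sub>c A"
  shows "Q3_free (col_supports A)"
proof (rule ccontr)
  let ?\<F> = "col_supports A"
  assume "\<not> Q3_free ?\<F>"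
  then obtain x y where "x \<noteq> y" and n: "\<not> ((\<forall>S\<in>?\<F>. x \<in> S \<or> y \<in> S) \<or> (\<forall>S\<in>?\<F>. x \<notin> S \<or> y \<notin> S) \<or>
     card {S\<in>?\<F>. x \<in> S \<and> y \<notin> S} \<le> 1 \<or> card {S\<in>?\<F>. y \<in> S \<and> x \<notin> S} \<le> 1)"
    unfolding Q3_free_def by meson
  then have XY: "card {S\<in>?\<F>. x \<in> S \<and> y \<notin> S} \<ge> 2" and YX: "card {S\<in>?\<F>. y \<in> S \<and> x \<notin> S} \<ge> 2"
    by linarith+
  obtain S T where S: "S \<in> ?\<F>" "x \<notin> S" "y \<notin> S" and T: "T \<in> ?\<F>" "x \<in> T" "y \<in> T"
    using n by blast
  obtain P P' where "P \<noteq> P'" and P: "P \<in> ?\<F>" "x \<in> P" "y \<notin> P" "P' \<in> ?\<F>" "x \<in> P'" "y \<notin> P'"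
    using XY by (rule two_le_cardE) auto
  obtain R R' where "R \<noteq> R'" and R: "R \<in> ?\<F>" "y \<in> R" "x \<notin> R" "R' \<in> ?\<F>" "y \<in> R'" "x \<notin> R'"
    using YX by (rule two_le_cardE) auto
  \<comment> \<open>The set \<open>T\<close> contains both \<open>x\<close> and \<open>y\<close>,
    which makes them row indices.\<close>
  have "x < dim_row A" "y < dim_row A"
    using T by (auto simp: col_supports_def col_support_def)
  \<comment> \<open>The list follows the column order of \<open>Q3\<close>: 00, 01, 01, 10, 10, 11
    on the rows \<open>x\<close>, \<open>y\<close>.\<close>
  moreover have "distinct [S, R, R', P, P', T]"
    using S T P R \<open>P \<noteq> P'\<close> \<open>R \<noteq> R'\<close> by auto
  moreover have "Q3 $$ (i, j) = of_bool ([x, y] ! i \<in> [S, R, R', P, P', T] ! j)"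
    if "i < 2" "j < 6" for i j
  proof -
    have "i \<in> {0, 1}" "j \<in> {0, 1, 2, 3, 4, 5}" using that by auto
    then show ?thesis
      using S T P R by (auto simp: Q3_def mat_of_rows_list_def)
  qed
  ultimately have "Q3 \<prec>\<^sub>c A"
    using S T P R \<open>x \<noteq> y\<close>
    by (intro in_config_if_col_supports[OF A, of "[x, y]" _ "[S, R, R', P, P', T]"]) auto
  with assms(2) show False by blast
qed

text \<open>On the four rows of a star, the sets \<open>P\<close>, \<open>Q\<close>,
  \<open>R\<close> form \<open>F10\<close> and \<open>S\<close> forms the zero column.\<close>

lemma no_star_col_supports:
  assumes A: "zero_one_mat A" and F: "F \<in> {F10, zeros_col4}" and "\<not> F \<prec>\<^sub>c A"
  shows "\<not> has_star (col_supports A)"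
proof
  let ?\<F> = "col_supports A"
  assume "has_star ?\<F>"
  then obtain a b c d P Q R S where dist: "distinct [a, b, c, d]" and d: "d \<in> \<Union>?\<F>"
    and sub: "{P, Q, R, S} \<subseteq> ?\<F>"
    and P: "P \<inter> {a, b, c, d} = {a}" and Q: "Q \<inter> {a, b, c, d} = {b}"
    and R: "R \<inter> {a, b, c, d} = {c}" and S: "S \<inter> {a, b, c, d} = {}"
    by (rule has_star.cases)
  have P': "a \<in> P" "b \<notin> P" "c \<notin> P" "d \<notin> P" and Q': "a \<notin> Q" "b \<in> Q" "c \<notin> Q" "d \<notin> Q"
    and R': "a \<notin> R" "b \<notin> R" "c \<in> R" "d \<notin> R" and S': "a \<notin> S" "b \<notin> S" "c \<notin> S" "d \<notin> S"
    using dist P Q R S by auto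
  have "\<Union>?\<F> \<subseteq> {..<dim_row A}" by (auto simp: col_supports_def col_support_def)
  then have rows: "set [a, b, c, d] \<subseteq> {..<dim_row A}"
    using P' Q' R' sub d by auto
  show False
  proof (cases "F = F10")
    case True
    have "F10 $$ (i, j) = of_bool ([a, b, c, d] ! i \<in> [P, Q, R] ! j)" if "i < 4" "j < 3" for i j
    proof -
      have "i \<in> {0, 1, 2, 3}" "j \<in> {0, 1, 2}" using that by auto
      then show ?thesis
        using P' Q' R' by (auto simp: F10_def mat_of_rows_list_def)
    qed
    moreover have "distinct [P, Q, R]" using P' Q' R' by auto
    ultimately have "F10 \<prec>\<^sub>c A"
      using dist rows sub
      by (intro in_config_if_col_supports[OF A, of "[a, b, c, d]" _ "[P, Q, R]"]) auto
    then show False using True assms(3) by blast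
  next
    case False
    have "zeros_col4 $$ (i, j) = of_bool ([a, b, c, d] ! i \<in> [S] ! j)" if "i < 4" "j < 1" for i j
    proof -
      have "i \<in> {0, 1, 2, 3}" "j = 0" using that by auto
      then show ?thesis using S' by (auto simp: zeros_col4_def)
    qed
    then have "zeros_col4 \<prec>\<^sub>c A"
      using dist rows sub
      by (intro in_config_if_col_supports[OF A, of "[a, b, c, d]" _ "[S]"]) auto
    then show False using False F assms(3) by blast
  qed
qed

lemma dim_col_avoiding_le:
  assumes "F \<in> {F10, zeros_col4}" "A \<in> avoiding m {Q3, F}"
  shows "dim_col A \<le> 3 * m + 1"
proof -
  have A: "dim_row A = m" "simple_mat A" "zero_one_mat A" "\<not> Q3 \<prec>\<^sub>c A" "\<not> F \<prec>\<^sub>c A"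
    using assms by (auto simp: avoiding_def simple_mat_def)
  have "card (col_supports A) \<le> 3 * card {..<m} + 1"
    using A assms(1)
    by (intro card_le_if_no_star Q3_free_col_supports no_star_col_supports[OF A(3) assms(1) A(5)])
      (auto simp: col_supports_def col_support_def)
  then show ?thesis using card_col_supports[OF A(2)] by simp
qed

section \<open>Complementation\<close>

lemma mat_compl_index [simp]:
  "dim_row (mat_compl A) = dim_row A" "dim_col (mat_compl A) = dim_col A"
  "i < dim_row A \<Longrightarrow> j < dim_col A \<Longrightarrow> mat_compl A $$ (i, j) = 1 - A $$ (i, j)"
  by (simp_all add: mat_compl_def)

lemma mat_compl_mat_compl [simp]: "mat_compl (mat_compl A) = A"
  by (rule eq_matI) auto

lemma in_config_mat_compl: "mat_compl F \<prec>\<^sub>c mat_compl A \<longleftrightarrow> F \<prec>\<^sub>c A"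
proof -
  have "mat_compl G \<prec>\<^sub>c mat_compl B" if GB: "G \<prec>\<^sub>c B" for G B
  proof -
    obtain r c where rc: "inj_on r {..<dim_row G}" "r ` {..<dim_row G} \<subseteq> {..<dim_row B}"
        "inj_on c {..<dim_col G}" "c ` {..<dim_col G} \<subseteq> {..<dim_col B}"
        "\<And>i j. i < dim_row G \<Longrightarrow> j < dim_col G \<Longrightarrow> G $$ (i, j) = B $$ (r i, c j)"
      using GB by (rule in_configE) (rule that)
    then show ?thesis
      by (intro in_configI[of r _ _ c]) (simp_all add: image_subset_iff)
  qed
  from this[of F A] this[of "mat_compl F" "mat_compl A"] show ?thesis by auto
qed

lemma Q3_in_config_mat_compl:
  assumes "Q3 \<prec>\<^sub>c A"
  shows "Q3 \<prec>\<^sub>c mat_compl A"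
proof -
  obtain r c where rc: "inj_on r {..<2}" "r ` {..<2} \<subseteq> {..<dim_row A}"
     "inj_on c {..<6}" "c ` {..<6} \<subseteq> {..<dim_col A}"
     "\<And>i j. i < 2 \<Longrightarrow> j < 6 \<Longrightarrow> Q3 $$ (i, j) = A $$ (r i, c j)"
    using assms by (rule in_configE) auto
  \<comment> \<open>Reversing the order of the columns, \<open>j\<close> to \<open>5 - j\<close>,
    turns \<open>Q3\<close> into its complement.\<close>
  have rev: "Q3 $$ (i, j) = 1 - Q3 $$ (i, 5 - j)" if "i < 2" "j < 6" for i j
  proof -
    have "i \<in> {0, 1}" "j \<in> {0, 1, 2, 3, 4, 5}" using that by auto
    then show ?thesis by (auto simp: Q3_def mat_of_rows_list_def)
  qed
  have "inj_on (\<lambda>j. c (5 - j)) {..<6}"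
    using rc(3) by (fastforce simp: inj_on_def)
  moreover have "Q3 $$ (i, j) = mat_compl A $$ (r i, c (5 - j))" if "i < 2" "j < 6" for i j
    using that rev[OF that] rc(2,4) rc(5)[of i "5 - j"] by (simp add: image_subset_iff)
  ultimately show ?thesis
    using rc(1,2,4)
    by (intro in_configI[of r _ _ "\<lambda>j. c (5 - j)"]) (auto simp: image_subset_iff)
qed

lemma simple_mat_mat_compl:
  assumes "simple_mat A"
  shows "simple_mat (mat_compl A)"
proof -
  have "zero_one_mat (mat_compl A)"
    using assms zero_one_matD[of A] by (intro zero_one_matI) (auto simp: simple_mat_def)
  moreover have "cols (mat_compl A) = map (map_vec (\<lambda>x. 1 - x)) (cols A)"
    by (auto simp: cols_def mat_compl_def)
  moreover have "inj (map_vec (\<lambda>x. 1 - x :: int))"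
    by (rule inj_on_inverseI[of _ "map_vec (\<lambda>x. 1 - x)"]) auto
  ultimately show ?thesis
    using assms by (auto simp: simple_mat_def distinct_map intro: inj_on_subset)
qed

lemma mat_compl_in_avoiding:
  assumes "A \<in> avoiding m {Q3, F}"
  shows "mat_compl A \<in> avoiding m {Q3, mat_compl F}"
  using assms simple_mat_mat_compl Q3_in_config_mat_compl[of "mat_compl A"]
  by (auto simp: avoiding_def in_config_mat_compl)

text \<open>Complementation is an involution that preserves dimensions and the avoidance of
  \<open>Q3\<close>, so it matches the two avoiding classes.\<close>

lemma forb_mat_compl: "forb m {Q3, mat_compl F} = forb m {Q3, F}"
proof -
  have sub: "dim_col ` avoiding m {Q3, G} \<subseteq> dim_col ` avoiding m {Q3, mat_compl G}" for G
    by (metis (no_types, lifting) image_subsetI image_eqI mat_compl_in_avoiding mat_compl_index(2))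
  have "dim_col ` avoiding m {Q3, mat_compl F} = dim_col ` avoiding m {Q3, F}"
    using sub[of F] sub[of "mat_compl F"] by (intro subset_antisym) simp_all
  then show ?thesis by (simp add: forb_def)
qed

section \<open>Lower bound and asymptotics\<close>

text \<open>Every column of the complement of the identity has a single zero, whereas column
  \<open>j\<close> of \<open>F\<close> has zeros in the two rows \<open>i\<close> and
  \<open>k\<close>.\<close>

lemma not_in_config_compl_one_mat:
  assumes "i < dim_row F" "k < dim_row F" "i \<noteq> k" "j < dim_col F"
    and "F $$ (i, j) = 0" "F $$ (k, j) = 0"
  shows "\<not> F \<prec>\<^sub>c mat_compl (1\<^sub>m m)"
proof
  assume "F \<prec>\<^sub>c mat_compl (1\<^sub>m m)"
  then obtain r c where "inj_on r {..<dim_row F}" "r ` {..<dim_row F} \<subseteq> {..<m}"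
     "c ` {..<dim_col F} \<subseteq> {..<m}"
     "\<And>i j. i < dim_row F \<Longrightarrow> j < dim_col F \<Longrightarrow> F $$ (i, j) = mat_compl (1\<^sub>m m) $$ (r i, c j)"
    by (rule in_configE) auto
  then have "r i < m" "r k < m" "c j < m" "r i \<noteq> r k"
     "mat_compl (1\<^sub>m m) $$ (r i, c j) = 0" "mat_compl (1\<^sub>m m) $$ (r k, c j) = 0"
    using assms by (auto simp: inj_on_def)
  then show False by (auto split: if_splits)
qed

lemma compl_one_mat_in_avoiding:
  assumes "F \<in> {F10, zeros_col4}"
  shows "mat_compl (1\<^sub>m m) \<in> avoiding m {Q3, F}"
proof -
  have "distinct (cols (1\<^sub>m m :: int mat))"
    by (auto simp: cols_def distinct_map intro!: inj_onI dest: unit_vec_eq[THEN iffD1, rotated])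
  then have "simple_mat (1\<^sub>m m)"
    by (auto simp: simple_mat_def intro!: zero_one_matI)
  then have "simple_mat (mat_compl (1\<^sub>m m))" by (rule simple_mat_mat_compl)
  moreover have "\<not> Q3 \<prec>\<^sub>c mat_compl (1\<^sub>m m)"
    by (rule not_in_config_compl_one_mat[of 0 _ 1 0]) (auto simp: Q3_def mat_of_rows_list_def)
  moreover have "\<not> F \<prec>\<^sub>c mat_compl (1\<^sub>m m)"
    using assms
    \<comment> \<open>Column 0 has zeros in rows 1 and 2 both for \<open>F10\<close> and for
      \<open>zeros_col4\<close>.\<close>
    by (intro not_in_config_compl_one_mat[of 1 _ 2 0])
      (auto simp: F10_def zeros_col4_def mat_of_rows_list_def)
  ultimately show ?thesis by (auto simp: avoiding_def)
qed

lemma forb_bounds: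
  assumes "F \<in> {F10, zeros_col4}"
  shows "m \<le> forb m {Q3, F}" "forb m {Q3, F} \<le> 3 * m + 1"
proof -
  have mem: "m \<in> dim_col ` avoiding m {Q3, F}"
    using compl_one_mat_in_avoiding[OF assms, of m] by (intro image_eqI) auto
  show "m \<le> forb m {Q3, F}"
    unfolding forb_def using finite_dim_col_avoiding mem by (rule Max_ge)
  show "forb m {Q3, F} \<le> 3 * m + 1"
    unfolding forb_def using mem finite_dim_col_avoiding dim_col_avoiding_le[OF assms]
    by (subst Max_le_iff) auto
qed

theorem corollary4p2:
  fixes F :: "int mat"
  assumes "F \<in> {ones_col4, F10, zeros_col4, mat_compl F10}"
  shows "(\<lambda>m. real (forb m {Q3, F})) \<in> \<Theta>(\<lambda>m. real m)"
proof -
  have ones: "ones_col4 = mat_compl zeros_col4"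
    by (rule eq_matI) (auto simp: ones_col4_def zeros_col4_def mat_compl_def)
  \<comment> \<open>The other two choices of \<open>F\<close> are the complements of
    \<open>zeros_col4\<close> and \<open>F10\<close>, and \<open>forb\<close> takes the same value
    on them.\<close>
  have bounds: "m \<le> forb m {Q3, F}" "forb m {Q3, F} \<le> 3 * m + 1" for m
    using assms forb_bounds[of F10 m] forb_bounds[of zeros_col4 m]
    by (auto simp: ones forb_mat_compl)
  show ?thesis
  proof (rule bigthetaI')
    show "\<forall>\<^sub>F m in at_top. 1 * norm (real m) \<le> norm (real (forb m {Q3, F})) \<and>
      norm (real (forb m {Q3, F})) \<le> 4 * norm (real m)"
      using eventually_ge_at_top[of 1]
    proof eventually_elim
      case (elim m)
      \<comment> \<open>The additive 1 is absorbed because \<open>m\<close> is at least 1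
        here.\<close>
      have "forb m {Q3, F} \<le> 4 * m" using bounds(2)[of m] elim by linarith
      then show ?case using bounds(1)[of m] by simp
    qed
  qed auto
qed

end
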